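(* In the setting of the context, suppose $s<1$, let $f\in C^{\ast\ast}$ be the unique fixed point of $T$, and let $\eta>0$. Suppose that the maps $l_n:I\to I$ have a uniform Lipschitz constant $\lambda_l<1$, i.e. $|l_n(x_1)-l_n(x_2)|\le\lambda_l|x_1-x_2|$ for all $x_1,x_2\in I$ and all $n=1,\dots,N$. Suppose that $S:I\to[-s,s]$ has Lipschitz constant $\lambda_S$, i.e. $|S(x_1)-S(x_2)|\le\lambda_S|x_1-x_2|$ for all $x_1,x_2\in I$. Let $\mathbb{X}=\{(x,y)\in I\times\mathbb{R}: |y-f(x)|\le\eta\}$. Then the iterated function system $(\mathbb{X};w_1,\dots,w_N)$ is contractive with respect to the metric $d_f$ with $\alpha=1$ and any $\beta$ satisfying $$0<\beta<\frac{1-\lambda_l}{\lambda_l\,\lambda_S\,\eta}$$ (this upper bound being read as $+\infty$ if $\lambda_S=0$). In particular, under these conditions, the iterated function system $\mathcal{W}=(I\times\mathbb{R};w_1,\dots,w_N)$ has a unique attractor $A=\Gamma(f)$, the graph of $f$, with basin of attraction $I\times\mathbb{R}$.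
   Context: Let $N\ge 1$ be an integer and let $(X_j,Y_j)\in\mathbb{R}^2$, $j=0,1,\dots,N$, with $X_0<X_1<\cdots<X_N$. Put $I=[X_0,X_N]$. For $n=1,\dots,N$ let $l_n:I\to[X_{n-1},X_n]$ be a continuous bijection. Define $L:I\to I$ by $L(x)=l_n^{-1}(x)$ for $x\in[X_{n-1},X_n)$, $n=1,\dots,N$, where for $n=N$ the interval is $[X_{N-1},X_N]$. Let $S:I\to\mathbb{R}$ be a function (Lipschitz continuous, by the hypothesis of the claim) and $s=\max\{|S(x)|:x\in I\}$. Let $C=C(I)$ be the set of continuous functions $I\to\mathbb{R}$ with the metric $d_\infty(f,g)=\max\{|f(x)-g(x)|:x\in I\}$, and let $C^{\ast}=\{f\in C: f(X_0)=Y_0,\ f(X_N)=Y_N\}$, $C^{\ast\ast}=\{f\in C: f(X_j)=Y_j,\ j=0,\dots,N\}$. Let $b\in C^{\ast}$, $h\in C^{\ast\ast}$, and define $T:C^{\ast}\to C^{\ast\ast}$ by $Tg=h+S\cdot(g\circ L-b\circ L)$. When $s<1$, $T$ is a contraction with respect to $d_\infty$ and has a unique fixed point $f\in C^{\ast\ast}$. For $n=1,\dots,N$ define $w_n:I\times\mathbb{R}\to I\times\mathbb{R}$ by $$w_n(x,y)=\bigl(l_n(x),\ h(l_n(x))+S(l_n(x))(y-b(x))\bigr).$$ When $s<1$, each $w_n$ maps $\mathbb{X}$ into $\mathbb{X}$. For $\alpha,\beta>0$ and $q:I\to\mathbb{R}$, the metric $d_q$ on $I\times\mathbb{R}$ is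 $$d_q((x_1,y_1),(x_2,y_2))=\alpha|x_1-x_2|+\beta\,|(y_1-q(x_1))-(y_2-q(x_2))|;$$ $d_f$ is the case $q=f$ (restricted to $\mathbb{X}$ where appropriate). An iterated function system (IFS) $\mathcal{F}=(\mathbb{Y};f_1,\dots,f_N)$ on a complete metric space $(\mathbb{Y},d)$ is a finite list of continuous maps $f_n:\mathbb{Y}\to\mathbb{Y}$. It is contractive (with respect to $d$) if there is a constant $c\in[0,1)$ such that $d(f_n(u),f_n(v))\le c\,d(u,v)$ for all $u,v\in\mathbb{Y}$ and all $n$. For $B\subset\mathbb{Y}$ put $\mathcal{F}(B)=\bigcup_n f_n(B)$, let $\mathcal{F}^k$ be the $k$-fold composition, and let $\mathbb{H}(U)$ be the set of nonempty compact subsets of $\mathbb{Y}$ contained in $U$. A nonempty compact set $A\subset\mathbb{Y}$ is an attractor of $\mathcal{F}$ if (i) $\mathcal{F}(A)=A$ and (ii) there is an open set $U\subset\mathbb{Y}$ with $A\subset U$ such that $\lim_{k\to\infty}\mathcal{F}^k(B)=A$ in the Hausdorff metric for all $B\in\mathbb{H}(U)$. The largest open $U$ for which (ii) holds is the basin of attraction of $A$. For $\mathcal{W}$ the space $I\times\mathbb{R}$ carries the Euclidean metric. *)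

theory Defs
  imports "HOL-Analysis.Analysis"
begin

section \<open>Iterated function systems on metric spaces\<close>

text \<open>The maps of a system are a list of functions on the ambient type; only their values on
  the carrier \<open>M\<close> matter.\<close>

definition is_IFS :: "'a set \<Rightarrow> ('a \<Rightarrow> 'a \<Rightarrow> real) \<Rightarrow> ('a \<Rightarrow> 'a) list \<Rightarrow> bool" where
  "is_IFS M d fs \<longleftrightarrow> Metric_space M d \<and> Metric_space.mcomplete M d \<and>
     (\<forall>g\<in>set fs. continuous_map (Metric_space.mtopology M d) (Metric_space.mtopology M d) g)"

definition contractive_IFS :: "'a set \<Rightarrow> ('a \<Rightarrow> 'a \<Rightarrow> real) \<Rightarrow> ('a \<Rightarrow> 'a) list \<Rightarrow> bool" where
  "contractive_IFS M d fs \<longleftrightarrow> is_IFS M d fs \<and>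
     (\<exists>c. 0 \<le> c \<and> c < 1 \<and> (\<forall>g\<in>set fs. \<forall>u\<in>M. \<forall>v\<in>M. d (g u) (g v) \<le> c * d u v))"

definition IFS_image :: "('a \<Rightarrow> 'a) list \<Rightarrow> 'a set \<Rightarrow> 'a set" where
  "IFS_image fs B = (\<Union>g\<in>set fs. g ` B)"

text \<open>Real-valued, hence meaningful only for nonempty bounded \<open>A\<close> and \<open>B\<close>; below it is
  applied to nonempty compact sets.\<close>

definition hausdorff_dist :: "('a \<Rightarrow> 'a \<Rightarrow> real) \<Rightarrow> 'a set \<Rightarrow> 'a set \<Rightarrow> real" where
  "hausdorff_dist d A B = max (SUP a\<in>A. INF b\<in>B. d a b) (SUP b\<in>B. INF a\<in>A. d a b)"

definition nonempty_compacts :: "'a set \<Rightarrow> ('a \<Rightarrow> 'a \<Rightarrow> real) \<Rightarrow> 'a set \<Rightarrow> 'a set set" where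
  "nonempty_compacts M d U =
     {B. B \<noteq> {} \<and> B \<subseteq> U \<and> compactin (Metric_space.mtopology M d) B}"

definition attracts_on ::
  "'a set \<Rightarrow> ('a \<Rightarrow> 'a \<Rightarrow> real) \<Rightarrow> ('a \<Rightarrow> 'a) list \<Rightarrow> 'a set \<Rightarrow> 'a set \<Rightarrow> bool" where
  "attracts_on M d fs A U \<longleftrightarrow> openin (Metric_space.mtopology M d) U \<and> A \<subseteq> U \<and>
     (\<forall>B\<in>nonempty_compacts M d U.
        (\<lambda>k. hausdorff_dist d ((IFS_image fs ^^ k) B) A) \<longlonglongrightarrow> 0)"

definition is_attractor ::
  "'a set \<Rightarrow> ('a \<Rightarrow> 'a \<Rightarrow> real) \<Rightarrow> ('a \<Rightarrow> 'a) list \<Rightarrow> 'a set \<Rightarrow> bool" where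
  "is_attractor M d fs A \<longleftrightarrow> A \<in> nonempty_compacts M d M \<and> IFS_image fs A = A \<and>
     (\<exists>U. attracts_on M d fs A U)"

definition is_basin ::
  "'a set \<Rightarrow> ('a \<Rightarrow> 'a \<Rightarrow> real) \<Rightarrow> ('a \<Rightarrow> 'a) list \<Rightarrow> 'a set \<Rightarrow> 'a set \<Rightarrow> bool" where
  "is_basin M d fs A U \<longleftrightarrow> attracts_on M d fs A U \<and> (\<forall>V. attracts_on M d fs A V \<longrightarrow> V \<subseteq> U)"

section \<open>Fractal interpolation\<close>

text \<open>Functions on \<open>I = {X 0..X N}\<close> are represented by total functions on the reals whose
  values outside \<open>I\<close> are irrelevant.\<close>

definition C_star :: "nat \<Rightarrow> (nat \<Rightarrow> real) \<Rightarrow> (nat \<Rightarrow> real) \<Rightarrow> (real \<Rightarrow> real) set" where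
  "C_star N X Y = {g. continuous_on {X 0..X N} g \<and> g (X 0) = Y 0 \<and> g (X N) = Y N}"

definition C_star_star :: "nat \<Rightarrow> (nat \<Rightarrow> real) \<Rightarrow> (nat \<Rightarrow> real) \<Rightarrow> (real \<Rightarrow> real) set" where
  "C_star_star N X Y = {g. continuous_on {X 0..X N} g \<and> (\<forall>j\<in>{0..N}. g (X j) = Y j)}"

text \<open>The index of the piece \<open>[X (n-1), X n)\<close> containing \<open>x\<close>; the last piece is closed.\<close>

definition piece_index :: "nat \<Rightarrow> (nat \<Rightarrow> real) \<Rightarrow> real \<Rightarrow> nat" where
  "piece_index N X x =
     (THE n. n \<in> {1..N} \<and> X (n - 1) \<le> x \<and> (x < X n \<or> n = N \<and> x = X N))"

definition L_map :: "nat \<Rightarrow> (nat \<Rightarrow> real) \<Rightarrow> (nat \<Rightarrow> real \<Rightarrow> real) \<Rightarrow> real \<Rightarrow> real" where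
  "L_map N X l x = inv_into {X 0..X N} (l (piece_index N X x)) x"

definition T_op ::
  "nat \<Rightarrow> (nat \<Rightarrow> real) \<Rightarrow> (nat \<Rightarrow> real \<Rightarrow> real) \<Rightarrow> (real \<Rightarrow> real) \<Rightarrow> (real \<Rightarrow> real) \<Rightarrow>
   (real \<Rightarrow> real) \<Rightarrow> (real \<Rightarrow> real) \<Rightarrow> (real \<Rightarrow> real)" where
  "T_op N X l S h b g = (\<lambda>x. h x + S x * (g (L_map N X l x) - b (L_map N X l x)))"

definition w_map ::
  "(nat \<Rightarrow> real \<Rightarrow> real) \<Rightarrow> (real \<Rightarrow> real) \<Rightarrow> (real \<Rightarrow> real) \<Rightarrow> (real \<Rightarrow> real) \<Rightarrow>
   nat \<Rightarrow> real \<times> real \<Rightarrow> real \<times> real" where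
  "w_map l S h b n = (\<lambda>(x, y). (l n x, h (l n x) + S (l n x) * (y - b x)))"

definition d_graph ::
  "real \<Rightarrow> real \<Rightarrow> (real \<Rightarrow> real) \<Rightarrow> real \<times> real \<Rightarrow> real \<times> real \<Rightarrow> real" where
  "d_graph \<alpha> \<beta> q = (\<lambda>(x1, y1) (x2, y2).
     \<alpha> * \<bar>x1 - x2\<bar> + \<beta> * \<bar>(y1 - q x1) - (y2 - q x2)\<bar>)"

end

theory Submission
  imports Defs
begin

text \<open>
  The proof rests on a change of the vertical coordinate. The functional equation \<open>T f = f\<close>
  says that \<open>f (l\<^sub>n x) = h (l\<^sub>n x) + S (l\<^sub>n x) (f x - b x)\<close>; subtracting it
  from the definition of \<open>w\<^sub>n\<close> gives
  \<open>w\<^sub>n (x, f x + v) = (l\<^sub>n x, f (l\<^sub>n x) + S (l\<^sub>n x) v)\<close>.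
  Measured by the height \<open>v\<close> above the graph of \<open>f\<close>, the system is therefore a skew
  product: \<open>l\<^sub>n\<close> acts on the base, and each fibre is scaled by a factor of modulus at
  most \<open>s\<close>. This is \<open>fixed_point_equation\<close>; its only delicate point is that \<open>L\<close> chooses
  one of two branches at an interior node; both branches lead to endpoints of \<open>I\<close>,
  where \<open>b\<close> and \<open>f\<close> agree, so that the choice has no effect.

  The metric \<open>d\<^sub>f\<close> is the weighted sum of base distance and height difference. The two heights
  are scaled by factors that differ by at most \<open>\<lambda>\<^sub>S \<lambda>\<^sub>l\<close> times the base
  distance, and heights are at most \<open>\<eta>\<close>, so the cross term costs
  \<open>\<beta> \<eta> \<lambda>\<^sub>S \<lambda>\<^sub>l\<close> of base distance. The contraction factor is
  \<open>max (\<lambda>\<^sub>l + \<beta> \<eta> \<lambda>\<^sub>S \<lambda>\<^sub>l) s\<close>, and the bound on \<open>\<beta>\<close> makes it less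
  than 1.

  The attractor is found directly in the Euclidean metric. After \<open>k\<close> steps every
  compact set lies within height \<open>s\<^sup>k\<close> times a constant of the graph
  (\<open>orbit_height\<close>), while its projection to the base comes within
  \<open>\<lambda>\<^sub>l\<^sup>k\<close> times the diameter of \<open>I\<close> of every point (\<open>orbit_base_dense\<close>). Uniform
  continuity of \<open>f\<close> turns these two facts into Hausdorff convergence to the graph, and
  for a compact set that the system leaves invariant they force equality with the graph.
\<close>

section \<open>Hausdorff distance and contractive systems\<close>

text \<open>Nonnegativity and \<open>e\<close> confine all distances to nearest points to a bounded range, where
  suprema and infima of reals have their usual meaning.\<close>

lemma hausdorff_dist_bounds:
  assumes ne: "A \<noteq> {}" "B \<noteq> {}" and nonneg: "\<And>x y. 0 \<le> d x y"
    and AB: "\<And>a. a \<in> A \<Longrightarrow> \<exists>b\<in>B. d a b \<le> e"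
    and BA: "\<And>b. b \<in> B \<Longrightarrow> \<exists>a\<in>A. d a b \<le> e"
  shows "0 \<le> hausdorff_dist d A B" and "hausdorff_dist d A B \<le> e"
proof -
  have I1: "(INF b\<in>B. d a b) \<le> e" if a: "a \<in> A" for a
  proof -
    obtain b where "b \<in> B" "d a b \<le> e" using AB[OF a] by blast
    moreover have "bdd_below ((\<lambda>b. d a b) ` B)" by (rule bdd_belowI2[OF nonneg])
    ultimately show ?thesis by (meson cINF_lower order_trans)
  qed
  have I2: "(INF a\<in>A. d a b) \<le> e" if b: "b \<in> B" for b
  proof -
    obtain a where "a \<in> A" "d a b \<le> e" using BA[OF b] by blast
    moreover have "bdd_below ((\<lambda>a. d a b) ` A)" by (rule bdd_belowI2[OF nonneg])
    ultimately show ?thesis by (meson cINF_lower order_trans)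
  qed
  show "hausdorff_dist d A B \<le> e"
    unfolding hausdorff_dist_def using ne I1 I2 by (auto intro!: cSUP_least)
  obtain a where a: "a \<in> A" using ne by blast
  have "0 \<le> (INF b\<in>B. d a b)" using ne nonneg by (auto intro!: cINF_greatest)
  also have "\<dots> \<le> (SUP a\<in>A. INF b\<in>B. d a b)"
    using a I1 by (intro cSUP_upper) (auto intro: bdd_aboveI2[OF I1])
  finally show "0 \<le> hausdorff_dist d A B"
    unfolding hausdorff_dist_def by simp
qed

lemma contractive_IFSI:
  assumes M: "Metric_space M d" "Metric_space.mcomplete M d"
    and self: "\<And>g. g \<in> set fs \<Longrightarrow> g ` M \<subseteq> M"
    and c: "0 \<le> c" "c < 1"
    and contr: "\<And>g u v. g \<in> set fs \<Longrightarrow> u \<in> M \<Longrightarrow> v \<in> M \<Longrightarrow> d (g u) (g v) \<le> c * d u v"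
  shows "contractive_IFS M d fs"
proof -
  interpret Metric_space M d by (rule M)
  have "continuous_map mtopology mtopology g" if g: "g \<in> set fs" for g
    unfolding metric_continuous_map[OF M(1)]
  proof (intro conjI ballI allI impI)
    show "g ` M \<subseteq> M" by (rule self[OF g])
    fix a and e :: real assume a: "a \<in> M" and e: "e > 0"
    have "d (g a) (g x) < e" if "x \<in> M" "d a x < e" for x
    proof -
      have "d (g a) (g x) \<le> c * d a x" by (rule contr[OF g a that(1)])
      also have "\<dots> \<le> d a x" using c by (simp add: mult_left_le_one_le)
      finally show ?thesis using that by simp
    qed
    then show "\<exists>\<delta>>0. \<forall>x. x \<in> M \<and> d a x < \<delta> \<longrightarrow> d (g a) (g x) < e"
      using e by blast
  qed
  then show ?thesis
    unfolding contractive_IFS_def is_IFS_def using M c contr by blast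
qed

section \<open>The metric \<open>d_graph\<close> on a neighbourhood of a graph\<close>

lemma Metric_space_d_graph:
  assumes "\<alpha> > 0" "\<beta> > 0"
  shows "Metric_space M (d_graph \<alpha> \<beta> q)"
proof
  fix p p' p'' :: "real \<times> real"
  obtain x y x' y' x'' y'' where p: "p = (x, y)" "p' = (x', y')" "p'' = (x'', y'')"
    by (metis surj_pair)
  show "0 \<le> d_graph \<alpha> \<beta> q p p'" using assms p by (simp add: d_graph_def)
  show "d_graph \<alpha> \<beta> q p p' = d_graph \<alpha> \<beta> q p' p"
    using p by (simp add: d_graph_def abs_minus_commute)
  show "d_graph \<alpha> \<beta> q p p' = 0 \<longleftrightarrow> p = p'"
    using assms p by (auto simp: d_graph_def add_nonneg_eq_0_iff)
  have "\<alpha> * \<bar>x - x''\<bar> \<le> \<alpha> * (\<bar>x - x'\<bar> + \<bar>x' - x''\<bar>)"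
    using assms by (intro mult_left_mono) auto
  moreover have "\<beta> * \<bar>(y - q x) - (y'' - q x'')\<bar>
      \<le> \<beta> * (\<bar>(y - q x) - (y' - q x')\<bar> + \<bar>(y' - q x') - (y'' - q x'')\<bar>)"
    using assms by (intro mult_left_mono) auto
  ultimately show "d_graph \<alpha> \<beta> q p p'' \<le> d_graph \<alpha> \<beta> q p p' + d_graph \<alpha> \<beta> q p' p''"
    using p by (simp add: d_graph_def algebra_simps)
qed

text \<open>The shear \<open>(x, y) \<mapsto> (x, y - q x)\<close> is an isometry onto \<open>I \<times> {-\<eta>..\<eta>}\<close> with a
  weighted sum metric, which is complete.\<close>

lemma mcomplete_d_graph:
  assumes pos: "\<alpha> > 0" "\<beta> > 0" and I: "closed I"
  shows "Metric_space.mcomplete {(x, y). x \<in> I \<and> \<bar>y - q x\<bar> \<le> \<eta>} (d_graph \<alpha> \<beta> q)"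
proof -
  let ?d = "d_graph \<alpha> \<beta> q"
  define M where "M = {(x, y). x \<in> I \<and> \<bar>y - q x\<bar> \<le> \<eta>}"
  interpret Metric_space M ?d by (rule Metric_space_d_graph[OF pos])
  show ?thesis
    unfolding M_def[symmetric] mcomplete_def
  proof (intro allI impI)
    fix \<sigma> assume \<sigma>: "MCauchy \<sigma>"
    define u where "u = fst \<circ> \<sigma>"
    define v where "v i = snd (\<sigma> i) - q (u i)" for i
    have \<sigma>M: "\<sigma> i \<in> M" for i using \<sigma> unfolding MCauchy_def by blast
    have uI: "u i \<in> I" and v\<eta>: "\<bar>v i\<bar> \<le> \<eta>" for i
      using \<sigma>M[of i] by (auto simp: M_def u_def v_def split_beta)
    have d: "?d (\<sigma> i) (\<sigma> j) = \<alpha> * \<bar>u i - u j\<bar> + \<beta> * \<bar>v i - v j\<bar>" for i j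
      by (simp add: d_graph_def u_def v_def split_beta)
    have small: "\<exists>m. \<forall>i\<ge>m. \<forall>j\<ge>m. \<alpha> * \<bar>u i - u j\<bar> + \<beta> * \<bar>v i - v j\<bar> < e" if "e > 0" for e
      using \<sigma> that by (simp add: MCauchy_def d)
    have "Cauchy u"
    proof (rule metric_CauchyI)
      fix e :: real assume "e > 0"
      then obtain m where m: "\<alpha> * \<bar>u i - u j\<bar> + \<beta> * \<bar>v i - v j\<bar> < \<alpha> * e"
        if "i \<ge> m" "j \<ge> m" for i j
        using small[of "\<alpha> * e"] pos by auto
      have "dist (u i) (u j) < e" if "i \<ge> m" "j \<ge> m" for i j
      proof -
        have "\<alpha> * \<bar>u i - u j\<bar> < \<alpha> * e"
          using m[OF that] pos(2) by (smt (verit) abs_ge_zero mult_nonneg_nonneg)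
        then show ?thesis using pos by (simp add: dist_real_def)
      qed
      then show "\<exists>m. \<forall>i\<ge>m. \<forall>j\<ge>m. dist (u i) (u j) < e" by blast
    qed
    then obtain x where x: "u \<longlonglongrightarrow> x" using Cauchy_convergent convergent_def by blast
    have "Cauchy v"
    proof (rule metric_CauchyI)
      fix e :: real assume "e > 0"
      then obtain m where m: "\<alpha> * \<bar>u i - u j\<bar> + \<beta> * \<bar>v i - v j\<bar> < \<beta> * e"
        if "i \<ge> m" "j \<ge> m" for i j
        using small[of "\<beta> * e"] pos by auto
      have "dist (v i) (v j) < e" if "i \<ge> m" "j \<ge> m" for i j
      proof -
        have "\<beta> * \<bar>v i - v j\<bar> < \<beta> * e"
          using m[OF that] pos(1) by (smt (verit) abs_ge_zero mult_nonneg_nonneg)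
        then show ?thesis using pos by (simp add: dist_real_def)
      qed
      then show "\<exists>m. \<forall>i\<ge>m. \<forall>j\<ge>m. dist (v i) (v j) < e" by blast
    qed
    then obtain z where z: "v \<longlonglongrightarrow> z" using Cauchy_convergent convergent_def by blast
    have "x \<in> I" using closed_sequentially[OF I] uI x by blast
    moreover have "\<bar>z\<bar> \<le> \<eta>"
      using tendsto_rabs[OF z] v\<eta> by (intro LIMSEQ_le_const2) auto
    ultimately have lim: "(x, q x + z) \<in> M" by (simp add: M_def)
    have "(\<lambda>i. \<alpha> * \<bar>u i - x\<bar> + \<beta> * \<bar>v i - z\<bar>) \<longlonglongrightarrow> \<alpha> * \<bar>x - x\<bar> + \<beta> * \<bar>z - z\<bar>"
      by (intro tendsto_intros x z)
    moreover have "?d (\<sigma> i) (x, q x + z) = \<alpha> * \<bar>u i - x\<bar> + \<beta> * \<bar>v i - z\<bar>" for i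
      by (simp add: d_graph_def u_def v_def split_beta)
    ultimately have "(\<lambda>i. ?d (\<sigma> i) (x, q x + z)) \<longlonglongrightarrow> 0" by simp
    then have "limitin mtopology \<sigma> (x, q x + z) sequentially"
      unfolding limitin_metric_dist_null using lim \<sigma>M by (simp add: eventually_sequentially)
    then show "\<exists>p. limitin mtopology \<sigma> p sequentially" by blast
  qed
qed

section \<open>Skew products over a base system\<close>

text \<open>The interpolation data with heights measured from the graph of \<open>f\<close>: a contractive
  base system whose pieces \<open>l n ` I\<close> cover a compact base, and over it a scaling of the fibres
  with varying ratio \<open>S\<close>.\<close>

locale graph_IFS =
  fixes I :: "real set" and J :: "nat set" and l :: "nat \<Rightarrow> real \<Rightarrow> real"
    and S f :: "real \<Rightarrow> real" and w :: "nat \<Rightarrow> real \<times> real \<Rightarrow> real \<times> real"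
    and ws :: "(real \<times> real \<Rightarrow> real \<times> real) list"
    and s lam_l lam_S :: real
  assumes compact_base: "compact I" and base_nonempty: "I \<noteq> {}"
    and continuous_f: "continuous_on I f"
    and cover: "I = (\<Union>n\<in>J. l n ` I)"
    and lipschitz_l: "\<And>n. n \<in> J \<Longrightarrow> lam_l-lipschitz_on I (l n)" and lam_l: "lam_l < 1"
    and lipschitz_S: "lam_S-lipschitz_on I S"
    and S_bound: "\<And>x. x \<in> I \<Longrightarrow> \<bar>S x\<bar> \<le> s" and s: "s < 1"
    and set_ws: "set ws = w ` J"
    and w_eq: "\<And>n x y. n \<in> J \<Longrightarrow> x \<in> I \<Longrightarrow> w n (x, y) = (l n x, f (l n x) + S (l n x) * (y - f x))"
begin

abbreviation "graph \<equiv> {(x, f x) | x. x \<in> I}"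
abbreviation "strip \<equiv> I \<times> (UNIV :: real set)"

lemma l_in_base: "n \<in> J \<Longrightarrow> x \<in> I \<Longrightarrow> l n x \<in> I"
  using cover by blast

lemma s_nonneg: "0 \<le> s"
  using S_bound base_nonempty by (meson abs_ge_zero ex_in_conv order_trans)

lemma lam_l_nonneg: "0 \<le> lam_l"
  using cover base_nonempty lipschitz_l lipschitz_on_nonneg by fastforce

lemma l_dist: "n \<in> J \<Longrightarrow> x \<in> I \<Longrightarrow> x' \<in> I \<Longrightarrow> \<bar>l n x - l n x'\<bar> \<le> lam_l * \<bar>x - x'\<bar>"
  using lipschitz_onD[OF lipschitz_l] by (simp add: dist_real_def)

lemma S_dist: "x \<in> I \<Longrightarrow> x' \<in> I \<Longrightarrow> \<bar>S x - S x'\<bar> \<le> lam_S * \<bar>x - x'\<bar>"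
  using lipschitz_onD[OF lipschitz_S] by (simp add: dist_real_def)

text \<open>Writing \<open>v = y - f x\<close> for heights, the height of the image moves by
  \<open>S (l x) v - S (l x') v' = S (l x) (v - v') + (S (l x) - S (l x')) v'\<close>; the first summand
  contracts by \<open>s\<close>, and the second is absorbed in the base distance.\<close>

lemma d_graph_contracts:
  assumes n: "n \<in> J" and x: "x \<in> I" "x' \<in> I" and v: "\<bar>y' - f x'\<bar> \<le> \<eta>" and \<beta>: "\<beta> > 0"
  shows "d_graph 1 \<beta> f (w n (x, y)) (w n (x', y'))
    \<le> max (lam_l + \<beta> * \<eta> * lam_S * lam_l) s * d_graph 1 \<beta> f (x, y) (x', y')"
proof -
  define v v' where "v = y - f x" and "v' = y' - f x'"
  define c where "c = max (lam_l + \<beta> * \<eta> * lam_S * lam_l) s"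
  have lam_S: "0 \<le> lam_S" using lipschitz_S by (rule lipschitz_on_nonneg)
  note l = l_in_base[OF n x(1)] l_in_base[OF n x(2)]
  have base: "\<bar>l n x - l n x'\<bar> \<le> lam_l * \<bar>x - x'\<bar>" by (rule l_dist[OF n x])
  have "\<bar>S (l n x) - S (l n x')\<bar> \<le> lam_S * (lam_l * \<bar>x - x'\<bar>)"
    using S_dist[OF l] mult_left_mono[OF base lam_S] by linarith
  then have cross: "\<bar>S (l n x) - S (l n x')\<bar> * \<bar>v'\<bar> \<le> lam_S * (lam_l * \<bar>x - x'\<bar>) * \<eta>"
    using v by (intro mult_mono) (auto simp: v'_def lam_S lam_l_nonneg)
  have "\<bar>S (l n x) * v - S (l n x') * v'\<bar>
      = \<bar>S (l n x) * (v - v') + (S (l n x) - S (l n x')) * v'\<bar>"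
    by (simp add: algebra_simps)
  also have "\<dots> \<le> \<bar>S (l n x)\<bar> * \<bar>v - v'\<bar> + \<bar>S (l n x) - S (l n x')\<bar> * \<bar>v'\<bar>"
    by (metis abs_mult abs_triangle_ineq)
  also have "\<dots> \<le> s * \<bar>v - v'\<bar> + lam_S * (lam_l * \<bar>x - x'\<bar>) * \<eta>"
    by (intro add_mono mult_right_mono S_bound l cross) auto
  finally have height: "\<bar>S (l n x) * v - S (l n x') * v'\<bar>
      \<le> s * \<bar>v - v'\<bar> + lam_S * (lam_l * \<bar>x - x'\<bar>) * \<eta>" .
  have "d_graph 1 \<beta> f (w n (x, y)) (w n (x', y'))
      = \<bar>l n x - l n x'\<bar> + \<beta> * \<bar>S (l n x) * v - S (l n x') * v'\<bar>"
    using n x by (simp add: w_eq d_graph_def v_def v'_def)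
  also have "\<dots> \<le> lam_l * \<bar>x - x'\<bar> + \<beta> * (s * \<bar>v - v'\<bar> + lam_S * (lam_l * \<bar>x - x'\<bar>) * \<eta>)"
    using \<beta> by (intro add_mono base mult_left_mono height) auto
  also have "\<dots> = (lam_l + \<beta> * \<eta> * lam_S * lam_l) * \<bar>x - x'\<bar> + s * (\<beta> * \<bar>v - v'\<bar>)"
    by (simp add: algebra_simps)
  also have "\<dots> \<le> c * \<bar>x - x'\<bar> + c * (\<beta> * \<bar>v - v'\<bar>)"
    using \<beta> by (intro add_mono mult_right_mono) (auto simp: c_def)
  also have "\<dots> = c * d_graph 1 \<beta> f (x, y) (x', y')"
    by (simp add: d_graph_def v_def v'_def algebra_simps)
  finally show ?thesis by (simp add: c_def)
qed

theorem contractive_near_graph: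
  assumes \<eta>: "\<eta> > 0" and \<beta>: "\<beta> > 0"
    and \<beta>_less: "lam_S \<noteq> 0 \<Longrightarrow> \<beta> < (1 - lam_l) / (lam_l * lam_S * \<eta>)"
  shows "contractive_IFS {(x, y). x \<in> I \<and> \<bar>y - f x\<bar> \<le> \<eta>} (d_graph 1 \<beta> f) ws"
proof (rule contractive_IFSI)
  let ?c = "max (lam_l + \<beta> * \<eta> * lam_S * lam_l) s"
  have lam_S: "0 \<le> lam_S" using lipschitz_S by (rule lipschitz_on_nonneg)
  have "lam_l + \<beta> * \<eta> * lam_S * lam_l < 1"
  proof (cases "lam_S = 0 \<or> lam_l = 0")
    case True
    \<comment> \<open>For \<open>lam_l = 0\<close> the bound on \<open>\<beta>\<close> is a division by zero; the cross term vanishes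
      in both cases.\<close>
    then show ?thesis using lam_l by auto
  next
    case False
    then have "0 < lam_l * lam_S * \<eta>" using lam_S lam_l_nonneg \<eta> by simp
    then have "\<beta> * (lam_l * lam_S * \<eta>) < 1 - lam_l"
      using \<beta>_less False by (simp add: pos_less_divide_eq)
    then show ?thesis by (simp add: mult_ac)
  qed
  then show "?c < 1" "0 \<le> ?c" using s s_nonneg by auto
  show "Metric_space {(x, y). x \<in> I \<and> \<bar>y - f x\<bar> \<le> \<eta>} (d_graph 1 \<beta> f)"
    using \<beta> by (intro Metric_space_d_graph) auto
  show "Metric_space.mcomplete {(x, y). x \<in> I \<and> \<bar>y - f x\<bar> \<le> \<eta>} (d_graph 1 \<beta> f)"
    using \<beta> compact_base by (intro mcomplete_d_graph compact_imp_closed) auto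
  fix g assume "g \<in> set ws"
  then obtain n where n: "n \<in> J" "g = w n" using set_ws by blast
  show "g ` {(x, y). x \<in> I \<and> \<bar>y - f x\<bar> \<le> \<eta>} \<subseteq> {(x, y). x \<in> I \<and> \<bar>y - f x\<bar> \<le> \<eta>}"
  proof clarify
    fix x y x' y' assume x: "x \<in> I" and y: "\<bar>y - f x\<bar> \<le> \<eta>" and g: "(x', y') = g (x, y)"
    have "\<bar>S (l n x)\<bar> * \<bar>y - f x\<bar> \<le> 1 * \<eta>"
      using S_bound[OF l_in_base[OF n(1) x]] s y by (intro mult_mono) auto
    then show "x' \<in> I \<and> \<bar>y' - f x'\<bar> \<le> \<eta>"
      using g n x l_in_base by (simp add: w_eq abs_mult)
  qed
  fix p p' assume "p \<in> {(x, y). x \<in> I \<and> \<bar>y - f x\<bar> \<le> \<eta>}" "p' \<in> {(x, y). x \<in> I \<and> \<bar>y - f x\<bar> \<le> \<eta>}"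
  then show "d_graph 1 \<beta> f (g p) (g p') \<le> ?c * d_graph 1 \<beta> f p p'"
    using d_graph_contracts n \<beta> by auto
qed

section \<open>The graph as global attractor\<close>

lemma Submetric_strip: "Submetric UNIV dist strip"
  by (simp add: Submetric_def Submetric_axioms_def Met_TC.Metric_space_axioms)

lemma mtopology_strip: "Metric_space.mtopology strip dist = top_of_set strip"
  using Submetric.mtopology_submetric[OF Submetric_strip] by simp

lemma mcomplete_strip: "Metric_space.mcomplete strip dist"
  by (rule Submetric.closedin_mcomplete_imp_mcomplete[OF Submetric_strip])
    (simp_all add: closed_Times compact_imp_closed compact_base complete_UNIV)

lemma nonempty_compacts_strip:
  "B \<in> nonempty_compacts strip dist U \<longleftrightarrow> B \<noteq> {} \<and> B \<subseteq> U \<and> B \<subseteq> strip \<and> compact B"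
  by (auto simp: nonempty_compacts_def mtopology_strip compactin_subtopology)

lemma is_IFS_strip: "is_IFS strip dist ws"
proof -
  have "continuous_map (top_of_set strip) (top_of_set strip) (w n)" if n: "n \<in> J" for n
  proof -
    have cl: "continuous_on strip (\<lambda>p. l n (fst p))"
      by (rule continuous_on_compose2[OF lipschitz_on_continuous_on[OF lipschitz_l[OF n]]])
        (auto intro!: continuous_intros)
    have cS: "continuous_on strip (\<lambda>p. S (l n (fst p)))"
      by (rule continuous_on_compose2[OF lipschitz_on_continuous_on[OF lipschitz_S] cl])
        (use n l_in_base in auto)
    have cfl: "continuous_on strip (\<lambda>p. f (l n (fst p)))"
      by (rule continuous_on_compose2[OF continuous_f cl]) (use n l_in_base in auto)
    have cf: "continuous_on strip (\<lambda>p. f (fst p))"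
      by (rule continuous_on_compose2[OF continuous_f]) (auto intro!: continuous_intros)
    have "continuous_on strip (\<lambda>p. (l n (fst p), f (l n (fst p)) + S (l n (fst p)) * (snd p - f (fst p))))"
      by (intro continuous_intros cl cS cfl cf)
    then have "continuous_on strip (w n)"
      by (rule continuous_on_eq) (use n in \<open>auto simp: w_eq\<close>)
    moreover have "w n ` strip \<subseteq> strip" using n l_in_base by (auto simp: w_eq)
    ultimately show ?thesis by (simp add: image_subset_iff_funcset)
  qed
  then show ?thesis
    unfolding is_IFS_def mtopology_strip
    using set_ws mcomplete_strip Met_TC.subspace[of strip] by auto
qed

lemma IFS_image_iff: "p \<in> IFS_image ws B \<longleftrightarrow> (\<exists>n\<in>J. \<exists>q\<in>B. p = w n q)"
  by (auto simp: IFS_image_def set_ws)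

lemma IFS_image_graph: "IFS_image ws graph = graph"
proof (intro equalityI subsetI)
  fix p assume "p \<in> IFS_image ws graph"
  then show "p \<in> graph" using l_in_base by (auto simp: IFS_image_iff w_eq)
next
  fix p assume "p \<in> graph"
  then obtain x where p: "p = (x, f x)" "x \<in> I" by blast
  then obtain n x0 where "n \<in> J" "x0 \<in> I" "x = l n x0" using cover by blast
  then have "w n (x0, f x0) = p" using p by (simp add: w_eq)
  then show "p \<in> IFS_image ws graph"
    using \<open>n \<in> J\<close> \<open>x0 \<in> I\<close> by (force simp: IFS_image_iff)
qed

lemma compact_graph: "compact graph"
proof -
  have "graph = (\<lambda>x. (x, f x)) ` I" by auto
  then show ?thesis
    by (auto intro!: compact_continuous_image continuous_intros continuous_f compact_base)
qed

lemma compact_height_bounded: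
  assumes "compact B" "B \<subseteq> strip"
  obtains H where "H > 0" "\<And>x y. (x, y) \<in> B \<Longrightarrow> \<bar>y - f x\<bar> \<le> H"
proof -
  have "continuous_on B (\<lambda>p. f (fst p))"
    using assms by (intro continuous_on_compose2[OF continuous_f]) (auto intro!: continuous_intros)
  then have "continuous_on B (\<lambda>p. snd p - f (fst p))" by (intro continuous_intros)
  then have "bounded ((\<lambda>p. snd p - f (fst p)) ` B)"
    using assms compact_continuous_image compact_imp_bounded by blast
  then show ?thesis
    using that unfolding bounded_pos by fastforce
qed

lemma orbit_height:
  assumes "B \<subseteq> strip" "\<And>x y. (x, y) \<in> B \<Longrightarrow> \<bar>y - f x\<bar> \<le> H"
  shows "(x, y) \<in> (IFS_image ws ^^ k) B \<Longrightarrow> x \<in> I \<and> \<bar>y - f x\<bar> \<le> s ^ k * H"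
proof (induction k arbitrary: x y)
  case 0
  then show ?case using assms by auto
next
  case (Suc k)
  then obtain n x0 y0 where n: "n \<in> J" and p: "(x0, y0) \<in> (IFS_image ws ^^ k) B"
    and w: "(x, y) = w n (x0, y0)"
    by (auto simp: IFS_image_iff)
  note IH = Suc.IH[OF p]
  have "\<bar>S (l n x0)\<bar> * \<bar>y0 - f x0\<bar> \<le> s * (s ^ k * H)"
    using IH S_bound l_in_base n s_nonneg by (intro mult_mono) auto
  then show ?case using w IH n l_in_base by (simp add: w_eq abs_mult mult_ac)
qed

text \<open>A point \<open>x\<close> of the base is \<open>l\<^sub>n\<^sub>1 (\<dots> (l\<^sub>n\<^sub>k x\<^sub>0))\<close> for some word
  \<open>n\<^sub>1 \<dots> n\<^sub>k\<close>; the same word applied to any point of \<open>B\<close> lands close to \<open>x\<close>.\<close>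

lemma orbit_base_dense:
  assumes "B \<noteq> {}" "B \<subseteq> strip"
  shows "x \<in> I \<Longrightarrow> \<exists>p\<in>(IFS_image ws ^^ k) B. fst p \<in> I \<and> \<bar>fst p - x\<bar> \<le> lam_l ^ k * diameter I"
proof (induction k arbitrary: x)
  case 0
  obtain p where p: "p \<in> B" "fst p \<in> I" using assms by fastforce
  have "dist (fst p) x \<le> diameter I"
    using p 0 compact_base by (intro diameter_bounded_bound compact_imp_bounded) auto
  then show ?case using p by (auto simp: dist_real_def)
next
  case (Suc k)
  then obtain n x0 where n: "n \<in> J" "x0 \<in> I" "x = l n x0" using cover by blast
  obtain x' y' where p: "(x', y') \<in> (IFS_image ws ^^ k) B" "x' \<in> I"
      "\<bar>x' - x0\<bar> \<le> lam_l ^ k * diameter I"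
    using Suc.IH[OF n(2)] by auto
  have "w n (x', y') \<in> (IFS_image ws ^^ Suc k) B"
    using p n by (auto simp: IFS_image_iff)
  moreover have "\<bar>l n x' - x\<bar> \<le> lam_l ^ Suc k * diameter I"
    using l_dist[OF n(1) p(2) n(2)] mult_left_mono[OF p(3) lam_l_nonneg] n
    by (simp add: mult_ac)
  ultimately show ?case
    using n p l_in_base by (metis fst_conv w_eq)
qed

lemma dist_le_abs_sum: "dist (x, y) (x', y') \<le> \<bar>x - x'\<bar> + \<bar>y - y'\<bar>" for x y x' y' :: real
  by (simp add: dist_Pair_Pair dist_real_def sqrt_sum_squares_le_sum_abs[THEN order_trans])

theorem attracts_on_graph: "attracts_on strip dist ws graph strip"
  unfolding attracts_on_def
proof (intro conjI ballI)
  show "openin (Metric_space.mtopology strip dist) strip" by (simp add: mtopology_strip)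
  show "graph \<subseteq> strip" by auto
  fix B assume "B \<in> nonempty_compacts strip dist strip"
  then have B: "B \<noteq> {}" "B \<subseteq> strip" "compact B" by (auto simp: nonempty_compacts_strip)
  obtain H where H: "H > 0" "\<And>x y. (x, y) \<in> B \<Longrightarrow> \<bar>y - f x\<bar> \<le> H"
    using compact_height_bounded B by blast
  show "(\<lambda>k. hausdorff_dist dist ((IFS_image ws ^^ k) B) graph) \<longlonglongrightarrow> 0"
  proof (rule metric_LIMSEQ_I)
    fix e :: real assume e: "e > 0"
    \<comment> \<open>Base distance, oscillation of \<open>f\<close> and height each contribute at most \<open>e / 4\<close>,
      which leaves room for the strict inequality.\<close>
    obtain \<delta> where \<delta>: "\<delta> > 0" "\<And>x x'. x \<in> I \<Longrightarrow> x' \<in> I \<Longrightarrow> \<bar>x' - x\<bar> < \<delta> \<Longrightarrow> \<bar>f x' - f x\<bar> < e / 4"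
      using compact_uniformly_continuous[OF continuous_f compact_base] e
      unfolding uniformly_continuous_on_def dist_real_def
      by (metis zero_less_divide_iff zero_less_numeral)
    have "(\<lambda>k. s ^ k * H) \<longlonglongrightarrow> 0 * H"
      using s s_nonneg by (intro tendsto_intros LIMSEQ_realpow_zero)
    then have "\<forall>\<^sub>F k in sequentially. s ^ k * H < e / 4"
      using e by (intro order_tendstoD(2)) auto
    moreover have "(\<lambda>k. lam_l ^ k * diameter I) \<longlonglongrightarrow> 0 * diameter I"
      using lam_l lam_l_nonneg by (intro tendsto_intros LIMSEQ_realpow_zero)
    then have "\<forall>\<^sub>F k in sequentially. lam_l ^ k * diameter I < min \<delta> (e / 4)"
      using e \<delta> by (intro order_tendstoD(2)) auto
    ultimately have "\<forall>\<^sub>F k in sequentially.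
        dist (hausdorff_dist dist ((IFS_image ws ^^ k) B) graph) 0 < e"
    proof eventually_elim
      fix k assume k: "s ^ k * H < e / 4" "lam_l ^ k * diameter I < min \<delta> (e / 4)"
      let ?B = "(IFS_image ws ^^ k) B"
      have height: "x \<in> I \<and> \<bar>y - f x\<bar> < e / 4" if "(x, y) \<in> ?B" for x y
        using orbit_height[OF B(2) H(2) that] k by auto
      have to_graph: "\<exists>q\<in>graph. dist p q \<le> 3 * e / 4" if "p \<in> ?B" for p
      proof -
        obtain x y where p: "p = (x, y)" by (cases p)
        have "dist p (x, f x) \<le> \<bar>y - f x\<bar>" using dist_le_abs_sum[of x y x "f x"] p by simp
        then have "dist p (x, f x) \<le> 3 * e / 4" using height[of x y] that p e by auto
        moreover have "(x, f x) \<in> graph" using height[of x y] that p by auto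
        ultimately show ?thesis by blast
      qed
      have from_graph: "\<exists>p\<in>?B. dist p q \<le> 3 * e / 4" if "q \<in> graph" for q
      proof -
        obtain x where q: "q = (x, f x)" "x \<in> I" using \<open>q \<in> graph\<close> by blast
        obtain x' y' where p: "(x', y') \<in> ?B" "x' \<in> I" "\<bar>x' - x\<bar> \<le> lam_l ^ k * diameter I"
          using orbit_base_dense[OF B(1,2) q(2)] by (metis fst_conv surj_pair)
        have "\<bar>f x' - f x\<bar> < e / 4" using \<delta>(2)[OF q(2) p(2)] p(3) k by simp
        then have "dist (x', y') q \<le> 3 * e / 4"
          using dist_le_abs_sum[of x' y' x "f x"] height[OF p(1)] p(3) k(2)
          unfolding q(1) min_less_iff_conj by linarith
        then show ?thesis using p by blast
      qed
      have "graph \<noteq> {}" using base_nonempty by auto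
      moreover have "?B \<noteq> {}" using from_graph \<open>graph \<noteq> {}\<close> by blast
      ultimately show "dist (hausdorff_dist dist ?B graph) 0 < e"
        using hausdorff_dist_bounds[of ?B graph dist "3 * e / 4"] to_graph from_graph e by simp
    qed
    then show "\<exists>no. \<forall>k\<ge>no. dist (hausdorff_dist dist ((IFS_image ws ^^ k) B) graph) 0 < e"
      by (simp add: eventually_sequentially)
  qed
qed

text \<open>An invariant set equals all of its iterates, so the bounds on iterates hold for it
  with every \<open>k\<close>: its heights vanish and its projection is dense in the base.\<close>

lemma invariant_compact_eq_graph:
  assumes A: "A \<in> nonempty_compacts strip dist strip" and inv: "IFS_image ws A = A"
  shows "A = graph"
proof -
  have B: "A \<noteq> {}" "A \<subseteq> strip" "compact A" using A by (auto simp: nonempty_compacts_strip)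
  have iter: "(IFS_image ws ^^ k) A = A" for k by (induction k) (simp_all add: inv)
  obtain H where H: "H > 0" "\<And>x y. (x, y) \<in> A \<Longrightarrow> \<bar>y - f x\<bar> \<le> H"
    using compact_height_bounded B by blast
  have on_graph: "x \<in> I \<and> y = f x" if p: "(x, y) \<in> A" for x y
  proof -
    have "\<bar>y - f x\<bar> \<le> s ^ k * H" for k
      using orbit_height[OF B(2) H(2), of x y k] p iter by simp
    moreover have "(\<lambda>k. s ^ k * H) \<longlonglongrightarrow> 0 * H"
      using s s_nonneg by (intro tendsto_intros LIMSEQ_realpow_zero)
    ultimately have "\<bar>y - f x\<bar> \<le> 0" by (intro LIMSEQ_le_const[of _ "0::real"]) auto
    then show ?thesis using p B by auto
  qed
  have "x \<in> fst ` A" if x: "x \<in> I" for x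
  proof (rule ccontr)
    have "closed (fst ` A)"
      using B by (intro compact_imp_closed compact_continuous_image continuous_intros)
    moreover assume "x \<notin> fst ` A"
    ultimately obtain e where e: "e > 0" "\<And>z. z \<in> fst ` A \<Longrightarrow> e \<le> dist x z"
      using separate_point_closed by metis
    have "(\<lambda>k. lam_l ^ k * diameter I) \<longlonglongrightarrow> 0 * diameter I"
      using lam_l lam_l_nonneg by (intro tendsto_intros LIMSEQ_realpow_zero)
    then have "\<forall>\<^sub>F k in sequentially. lam_l ^ k * diameter I < e"
      using e by (intro order_tendstoD(2)) auto
    then obtain k where k: "lam_l ^ k * diameter I < e" by (auto simp: eventually_sequentially)
    obtain p where "p \<in> A" "\<bar>fst p - x\<bar> \<le> lam_l ^ k * diameter I"
      using orbit_base_dense[OF B(1,2) x, of k] iter by auto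
    then show False using e(2)[of "fst p"] k by (simp add: dist_real_def abs_minus_commute)
  qed
  then show ?thesis using on_graph by force
qed

theorem is_attractor_iff_graph: "is_attractor strip dist ws A \<longleftrightarrow> A = graph"
proof
  assume "is_attractor strip dist ws A"
  then show "A = graph" using invariant_compact_eq_graph by (auto simp: is_attractor_def)
next
  assume A: "A = graph"
  have "graph \<in> nonempty_compacts strip dist strip"
    using base_nonempty compact_graph by (auto simp: nonempty_compacts_strip)
  then show "is_attractor strip dist ws A"
    unfolding is_attractor_def A using IFS_image_graph attracts_on_graph by blast
qed

theorem is_basin_graph: "is_basin strip dist ws graph strip"
proof -
  have "V \<subseteq> strip" if "attracts_on strip dist ws graph V" for V
    using that openin_subset[of "top_of_set strip" V] by (simp add: attracts_on_def mtopology_strip)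
  then show ?thesis using attracts_on_graph by (simp add: is_basin_def)
qed

end

section \<open>Interpolation nodes and the functional equation\<close>

lemma node_intervals_cover:
  fixes X :: "nat \<Rightarrow> real"
  assumes N: "N \<ge> 1" and X: "strict_mono_on {0..N} X"
  shows "{X 0..X N} = (\<Union>n\<in>{1..N}. {X (n - 1)..X n})"
proof (intro equalityI subsetI)
  have mono: "X i \<le> X j" if "i \<le> j" "j \<le> N" for i j
    using strict_mono_on_leD[OF X, of i j] that by auto
  fix z
  {
    assume "z \<in> (\<Union>n\<in>{1..N}. {X (n - 1)..X n})"
    then obtain n where n: "n \<in> {1..N}" "X (n - 1) \<le> z" "z \<le> X n" by auto
    then have "X 0 \<le> X (n - 1)" "X n \<le> X N" by (auto intro!: mono)
    then show "z \<in> {X 0..X N}" using n by auto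
  next
    assume z: "z \<in> {X 0..X N}"
    define n where "n = (LEAST n. z \<le> X n)"
    have "n \<le> N" "z \<le> X n" unfolding n_def using z by (auto intro: Least_le LeastI)
    show "z \<in> (\<Union>n\<in>{1..N}. {X (n - 1)..X n})"
    proof (cases "n = 0")
      case True
      then have "z = X 0" using z \<open>z \<le> X n\<close> by simp
      then have "z \<in> {X (1 - 1)..X 1}" using mono[of 0 1] N by simp
      then show ?thesis using N by (intro UN_I[of 1]) auto
    next
      case False
      then have "\<not> z \<le> X (n - 1)" unfolding n_def by (intro not_less_Least) auto
      then have "z \<in> {X (n - 1)..X n}" using \<open>z \<le> X n\<close> by simp
      then show ?thesis using False \<open>n \<le> N\<close> by (intro UN_I[of n]) auto
    qed
  }
qed

lemma piece_index_eq:
  assumes X: "strict_mono_on {0..N} X"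
    and n: "n \<in> {1..N}" "X (n - 1) \<le> z" "z < X n \<or> n = N \<and> z = X N"
  shows "piece_index N X z = n"
  unfolding piece_index_def
proof (rule the_equality)
  show "n \<in> {1..N} \<and> X (n - 1) \<le> z \<and> (z < X n \<or> n = N \<and> z = X N)" using n by blast
  fix m assume m: "m \<in> {1..N} \<and> X (m - 1) \<le> z \<and> (z < X m \<or> m = N \<and> z = X N)"
  have False if "i < j" "j \<le> N" "z < X i \<or> i = N \<and> z = X N" "X (j - 1) \<le> z" for i j
  proof -
    have "X i \<le> X (j - 1)" using that by (intro strict_mono_on_leD[OF X]) auto
    then show False using that by auto
  qed
  from this[of m n] this[of n m] show "m = n" using m n by (cases m n rule: linorder_cases) auto
qed

text \<open>Injectivity makes the map strictly monotone, in either direction, so that interior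
  points cannot reach the ends of the image.\<close>

lemma endpoint_preimage:
  fixes l :: "real \<Rightarrow> real"
  assumes cont: "continuous_on {a..b} l" and bij: "bij_betw l {a..b} {c..d}"
    and x: "x \<in> {a..b}" and lx: "l x = c \<or> l x = d"
  shows "x = a \<or> x = b"
proof (rule ccontr)
  assume "\<not> (x = a \<or> x = b)"
  then have "a < x" "x < b" using x by auto
  then have "l a < l x \<and> l x < l b \<or> l b < l x \<and> l x < l a"
    using continuous_inj_imp_mono cont bij by (metis bij_betw_def)
  moreover have "l a \<in> {c..d}" "l b \<in> {c..d}" using bij x by (auto simp: bij_betw_def)
  ultimately show False using lx by auto
qed

text \<open>At \<open>z = l n x\<close> the map \<open>L\<close> returns \<open>x\<close>, except when \<open>z\<close> is an interior node
  \<open>X n\<close>, where it uses the branch \<open>n + 1\<close>. In that case \<open>x\<close> is an endpoint of the base,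
  so \<open>f x = b x\<close>, and \<open>f\<close> and \<open>h\<close> both take the value \<open>Y n\<close> at \<open>z\<close>.\<close>

lemma fixed_point_equation:
  assumes N: "N \<ge> 1" and X: "strict_mono_on {0..N} X"
    and cont: "continuous_on {X 0..X N} (l n)"
    and bij: "bij_betw (l n) {X 0..X N} {X (n - 1)..X n}"
    and b: "b \<in> C_star N X Y" and h: "h \<in> C_star_star N X Y" and f: "f \<in> C_star_star N X Y"
    and fp: "\<And>x. x \<in> {X 0..X N} \<Longrightarrow> T_op N X l S h b f x = f x"
    and n: "n \<in> {1..N}" and x: "x \<in> {X 0..X N}"
  shows "f (l n x) = h (l n x) + S (l n x) * (f x - b x)"
proof -
  have z: "l n x \<in> {X (n - 1)..X n}" using bij x by (auto simp: bij_betw_def)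
  show ?thesis
  proof (cases "l n x < X n \<or> n = N \<and> l n x = X N")
    case True
    then have "piece_index N X (l n x) = n" using piece_index_eq[OF X n] z by auto
    then have "L_map N X l (l n x) = x"
      using bij x by (simp add: L_map_def bij_betw_def)
    moreover have "l n x \<in> {X 0..X N}" using node_intervals_cover[OF N X] n z by blast
    ultimately show ?thesis using fp[of "l n x"] by (simp add: T_op_def)
  next
    case False
    then have eq: "l n x = X n" using z by auto
    then have "x = X 0 \<or> x = X N" using endpoint_preimage[OF cont bij x] by blast
    then have "f x = b x" using b f by (auto simp: C_star_def C_star_star_def)
    then show ?thesis using eq h f n by (simp add: C_star_star_def)
  qed
qed

section \<open>Fractal interpolation functions as attractors\<close>

theorem theorem4:
  fixes N :: nat and X Y :: "nat \<Rightarrow> real"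
    and l :: "nat \<Rightarrow> real \<Rightarrow> real"
    and S b h f :: "real \<Rightarrow> real"
    and s \<eta> lam_l lam_S :: real
  defines "I \<equiv> {X 0..X N}"
    and "ws \<equiv> map (w_map l S h b) [1..<Suc N]"
  assumes "N \<ge> 1"
    and "strict_mono_on {0..N} X"
    and "\<And>n. n \<in> {1..N} \<Longrightarrow> continuous_on I (l n)"
    and "\<And>n. n \<in> {1..N} \<Longrightarrow> bij_betw (l n) I {X (n - 1)..X n}"
    and "\<exists>x\<in>I. \<bar>S x\<bar> = s" and "\<And>x. x \<in> I \<Longrightarrow> \<bar>S x\<bar> \<le> s"
    and "s < 1"
    and "b \<in> C_star N X Y" and "h \<in> C_star_star N X Y"
    and "f \<in> C_star_star N X Y" and "\<And>x. x \<in> I \<Longrightarrow> T_op N X l S h b f x = f x"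
    and "\<eta> > 0"
    and "lam_l < 1" and "\<And>n. n \<in> {1..N} \<Longrightarrow> lam_l-lipschitz_on I (l n)"
    and "lam_S-lipschitz_on I S"
  shows "(\<forall>\<beta>>0. (lam_S \<noteq> 0 \<longrightarrow> \<beta> < (1 - lam_l) / (lam_l * lam_S * \<eta>)) \<longrightarrow>
            contractive_IFS {(x, y). x \<in> I \<and> \<bar>y - f x\<bar> \<le> \<eta>} (d_graph 1 \<beta> f) ws) \<and>
         is_IFS (I \<times> UNIV) dist ws \<and>
         (\<forall>A. is_attractor (I \<times> UNIV) dist ws A \<longleftrightarrow> A = {(x, f x) | x. x \<in> I}) \<and>
         is_basin (I \<times> UNIV) dist ws {(x, f x) | x. x \<in> I} (I \<times> UNIV)"
proof -
  note N = assms(3) and X = assms(4) and cont = assms(5) and bij = assms(6)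
  have X0N: "X 0 \<le> X N" using strict_mono_on_leD[OF X, of 0 N] by simp
  interpret graph_IFS I "{1..N}" l S f "w_map l S h b" ws s lam_l lam_S
  proof
    show "compact I" "I \<noteq> {}" using X0N by (auto simp: I_def)
    show "continuous_on I f" using \<open>f \<in> C_star_star N X Y\<close> by (simp add: C_star_star_def I_def)
    show "I = (\<Union>n\<in>{1..N}. l n ` I)"
      using node_intervals_cover[OF N X] bij by (simp add: bij_betw_def I_def)
    show "set ws = w_map l S h b ` {1..N}" by (auto simp: ws_def)
    fix n x y assume n: "n \<in> {1..N}" and x: "x \<in> I"
    have "f (l n x) = h (l n x) + S (l n x) * (f x - b x)"
      using fixed_point_equation[OF N X cont[OF n, unfolded I_def] bij[OF n, unfolded I_def]
          assms(10-12) assms(13)[unfolded I_def] n x[unfolded I_def]] .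
    then show "w_map l S h b n (x, y) = (l n x, f (l n x) + S (l n x) * (y - f x))"
      by (simp add: w_map_def algebra_simps)
  qed (use assms in auto)
  show ?thesis
    using contractive_near_graph[OF \<open>\<eta> > 0\<close>] is_IFS_strip is_attractor_iff_graph is_basin_graph
    by blast
qed

end
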